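(* Let $q$ be a power of a prime $p$, and let $n=p^an'$ be a positive integer with $a=v_p(n)$ and $\gcd(p,n')=1$. Then in $\mathbb F_q[B,C]$: (1) $\Lambda_n(B,C)=\Lambda_{n'}(B,C)^{\varphi(p^a)}$; (2) $\mathcal V_n(B,C)=\mathcal V_{n'}(B,C)^{p^a}$; (3) $\mathcal U_n(B,C)=(B^2-4C)^{\frac{p^a-1}{2}}\,\mathcal U_{n'}(B,C)^{p^a}$ if $p$ is odd, and $\mathcal U_n(B,C)=B^{2^a-1}\,\mathcal U_{n'}(B,C)^{2^a}$ if $p=2$.
   Context: $v_p$ is the $p$-adic valuation and $\varphi$ is Euler's totient function. Let $B,C$ be algebraically independent indeterminates over $\mathbb F_q$. Lucas polynomials: $\mathcal U_0=0$, $\mathcal U_1=1$, $\mathcal U_n=-B\,\mathcal U_{n-1}-C\,\mathcal U_{n-2}$ and $\mathcal V_0=2$, $\mathcal V_1=-B$, $\mathcal V_n=-B\,\mathcal V_{n-1}-C\,\mathcal V_{n-2}$ for $n\ge2$. Lucas atoms: let $\alpha,\beta$ be the two roots of $T^2+BT+C$ in an algebraic closure of $\mathbb F_q(B,C)$. Let $\Phi_n(X)\in\mathbb F_q[X]$ be the $n$-th cyclotomic polynomial over $\mathbb F_q$ (the image of the integral one, also when $p\mid n$), and $\Phi_n^{\mathrm{hom}}(\alpha,\beta)=\beta^{\varphi(n)}\Phi_n(\alpha/\beta)$. The $n$-th Lucas atom $\Lambda_n(B,C)\in\mathbb F_q[B,C]$ is defined by $\Lambda_1(B,C)=1$ for $n=1$,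 and for $n\ge2$ as the unique polynomial with $\Lambda_n(B,C)=\Phi_n^{\mathrm{hom}}(\alpha,\beta)$.
   Formalization: Part (1) is stated except when n'=1 and a>0, where it is false under the convention Λ_1=1: there Λ_{p^a}=(α-β)^{φ(p^a)}≠1 (for example, for p=n=2, Λ_2=-B while Λ_1^{φ(2)}=1). *)

theory Defs
  imports
    Complex_Main
    "HOL-Computational_Algebra.Computational_Algebra"
    "HOL-Number_Theory.Totient"
    "HOL-Algebra.Algebraic_Closure_Type"
begin

text \<open>
  \<open>F[B,C]\<close> is modelled as the iterated polynomial ring \<open>(F[B])[C]\<close>, that is, as \<open>'a poly poly\<close>.
  Its field of fractions is \<open>'a poly poly fract\<close>.
\<close>

definition var_B :: "'a :: comm_ring_1 poly poly" where
  "var_B = [:[:0, 1:]:]"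

definition var_C :: "'a :: comm_ring_1 poly poly" where
  "var_C = [:0, 1:]"

fun lucas_U :: "nat \<Rightarrow> 'a :: comm_ring_1 poly poly" where
  "lucas_U 0 = 0"
| "lucas_U (Suc 0) = 1"
| "lucas_U (Suc (Suc n)) = - var_B * lucas_U (Suc n) - var_C * lucas_U n"

fun lucas_V :: "nat \<Rightarrow> 'a :: comm_ring_1 poly poly" where
  "lucas_V 0 = 2"
| "lucas_V (Suc 0) = - var_B"
| "lucas_V (Suc (Suc n)) = - var_B * lucas_V (Suc n) - var_C * lucas_V n"

text \<open>
  The integral cyclotomic polynomial: the integer polynomial whose complex roots are
  precisely the primitive \<open>n\<close>-th roots of unity, each of them simple.
\<close>

definition cyclotomic_int :: "nat \<Rightarrow> int poly" where
  "cyclotomic_int n = (THE P. map_poly complex_of_int P =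
     (\<Prod>k\<in>totatives n. [:- cis (2 * pi * real k / real n), 1:]))"

definition cyclotomic :: "nat \<Rightarrow> 'a :: field poly" where
  "cyclotomic n = map_poly of_int (cyclotomic_int n)"

definition to_closure :: "'a :: field poly poly \<Rightarrow> 'a poly poly fract alg_closure" where
  "to_closure P = to_ac (to_fract P)"

definition cyclotomic_hom ::
  "nat \<Rightarrow> 'a :: field poly poly fract alg_closure \<Rightarrow> 'a poly poly fract alg_closure
     \<Rightarrow> 'a poly poly fract alg_closure" where
  "cyclotomic_hom n \<alpha> \<beta> =
     \<beta> ^ totient n * poly (map_poly (\<lambda>c. to_closure [:[:c:]:]) (cyclotomic n)) (\<alpha> / \<beta>)"

text \<open>
  The two roots of \<open>T\<^sup>2 + B T + C\<close> are given by the factorisation into linear factors, which determines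
  them only up to order; the characterisation of the Lucas atom is required for both orders.

  The convention \<open>\<Lambda>\<^sub>1 = 1\<close> replaces \<open>\<Phi>\<^sub>1\<^sup>h\<^sup>o\<^sup>m(\<alpha>, \<beta>) = \<alpha> - \<beta>\<close>, which is not a polynomial in \<open>B\<close> and \<open>C\<close>
  unless the characteristic is 2. Consequently, in characteristic \<open>p\<close> and for \<open>a > 0\<close>, the atom
  \<open>\<Lambda>\<close> at \<open>p^a\<close> is \<open>(\<alpha> - \<beta>)\<close> to the power \<open>\<phi>(p^a)\<close> and not a power of \<open>\<Lambda>\<^sub>1\<close>; for instance \<open>\<Lambda>\<^sub>2 = - B \<noteq> \<Lambda>\<^sub>1\<close>.
\<close>

definition lucas_atom :: "nat \<Rightarrow> 'a :: field poly poly" where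
  "lucas_atom n = (if n = 1 then 1 else
     (THE L. \<forall>\<alpha> \<beta>. [:- \<alpha>, 1:] * [:- \<beta>, 1:] = [:to_closure var_C, to_closure var_B, 1:] \<longrightarrow>
        to_closure L = cyclotomic_hom n \<alpha> \<beta>))"

end

theory Submission
  imports Defs "HOL-Number_Theory.Residues"
begin

text \<open>
  Let \<open>\<alpha>\<close>, \<open>\<beta>\<close> be the roots of \<open>T^2 + B T + C\<close>. Then \<open>V_n = \<alpha>^n + \<beta>^n\<close>,
  \<open>(\<alpha> - \<beta>) U_n = \<alpha>^n - \<beta>^n\<close> and \<open>(\<alpha> - \<beta>)^2 = B^2 - 4 C\<close>, so the identities for \<open>U\<close> and \<open>V\<close>
  are instances of the Frobenius map; in characteristic 2, \<open>\<alpha> - \<beta> = B\<close>. For the atoms, a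
  nonzero function on the positive integers is determined by its products over divisors, and
  \<open>X^n - 1\<close> is the divisor product of the cyclotomic polynomials. Frobenius applied to
  \<open>X^m - 1\<close> thus gives \<open>\<Phi>_m^(p^a) = (\<Prod>i\<le>a. \<Phi>_(p^i m))\<close>, hence
  \<open>\<Phi>_(p^a m) = \<Phi>_m^\<phi>(p^a)\<close>, for \<open>m\<close> coprime to \<open>p\<close>. The same uniqueness shows that \<open>\<Phi>_n\<close> is
  palindromic for \<open>n > 1\<close>, so its homogenisation is symmetric in \<open>\<alpha>\<close>, \<open>\<beta>\<close> and the atoms exist.
\<close>

section \<open>Ring homomorphisms and polynomials\<close>

text \<open>Shared by the reduction of integer coefficients, the embedding into the closure, the
  embedding of constants, and coefficientwise maps of polynomials.\<close>

locale comm_ring_morphism =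
  fixes h :: "'a :: comm_ring_1 \<Rightarrow> 'b :: comm_ring_1"
  assumes hom_add: "h (x + y) = h x + h y"
    and hom_mult: "h (x * y) = h x * h y"
    and hom_one: "h 1 = 1"
begin

lemma hom_zero: "h 0 = 0"
  using hom_add[of 0 0] by simp

lemma hom_uminus: "h (- x) = - h x"
  using hom_add[of x "- x"] by (simp add: hom_zero add_eq_0_iff2)

lemma hom_diff: "h (x - y) = h x - h y"
  using hom_add[of x "- y"] by (simp add: hom_uminus)

lemma hom_sum: "h (sum f A) = (\<Sum>x\<in>A. h (f x))"
  by (induction A rule: infinite_finite_induct) (simp_all add: hom_zero hom_add)

lemma hom_prod: "h (prod f A) = (\<Prod>x\<in>A. h (f x))"
  by (induction A rule: infinite_finite_induct) (simp_all add: hom_one hom_mult)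

lemma hom_power: "h (x ^ n) = h x ^ n"
  by (induction n) (simp_all add: hom_one hom_mult)

lemma hom_numeral: "h (numeral k) = numeral k"
proof -
  have "h (of_nat n) = of_nat n" for n
    by (induction n) (simp_all add: hom_zero hom_add hom_one)
  from this[of "numeral k"] show ?thesis by simp
qed

lemma map_poly_morphism: "comm_ring_morphism (map_poly h)"
proof
  fix p q :: "'a poly"
  show "map_poly h (p + q) = map_poly h p + map_poly h q"
    by (rule poly_eqI) (simp add: coeff_map_poly hom_zero hom_add)
  show "map_poly h (p * q) = map_poly h p * map_poly h q"
    by (rule poly_eqI) (simp add: coeff_map_poly hom_zero coeff_mult hom_sum hom_mult)
  show "map_poly h 1 = 1"
    by (simp add: hom_one)
qed

end

interpretation of_int: comm_ring_morphism "of_int :: int \<Rightarrow> 'a :: comm_ring_1"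
  by standard auto

interpretation of_int_poly: comm_ring_morphism "map_poly of_int :: int poly \<Rightarrow> 'a :: comm_ring_1 poly"
  by (rule of_int.map_poly_morphism)

section \<open>Integer polynomials and monic division\<close>

lemma degree_map_poly_of_int:
  "Polynomial.degree (map_poly of_int u :: 'a :: {comm_ring_1, ring_char_0} poly) = Polynomial.degree u"
  by (rule degree_map_poly) simp

lemma lead_coeff_map_poly_of_int:
  "lead_coeff (map_poly of_int u :: 'a :: {comm_ring_1, ring_char_0} poly) = of_int (lead_coeff u)"
  by (simp add: coeff_map_poly degree_map_poly_of_int)

lemma map_poly_of_int_eq_iff:
  "map_poly of_int u = (map_poly of_int v :: 'a :: {comm_ring_1, ring_char_0} poly) \<longleftrightarrow> u = v"
  by (simp add: poly_eq_iff coeff_map_poly)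

text \<open>Pseudo-division scales the dividend only by a power of the leading coefficient of
  \<open>g\<close>, which is 1 here.\<close>

lemma monic_euclidean_division:
  fixes f g :: "'a :: idom poly"
  assumes "lead_coeff g = 1"
  obtains s r where "f = g * s + r" and "r = 0 \<or> Polynomial.degree r < Polynomial.degree g"
proof -
  obtain s r where sr: "pseudo_divmod f g = (s, r)"
    by fastforce
  have "g \<noteq> 0"
    using assms by auto
  from pseudo_divmod[OF this sr] that show thesis
    by (simp add: assms)
qed

text \<open>
  Over the integers, a monic divisor that exists after extending scalars to a field of
  characteristic 0 already has an integral cofactor, because the remainder of the
  division is unique.
\<close>
lemma integral_cofactor:
  fixes k :: "'a :: field_char_0 poly"
  assumes "lead_coeff g = 1"
    and "map_poly of_int f = map_poly of_int g * k"
  obtains s :: "int poly" where "map_poly of_int s = k"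
proof -
  obtain s r where sr: "f = g * s + r" "r = 0 \<or> Polynomial.degree r < Polynomial.degree g"
    using monic_euclidean_division[OF assms(1)] .
  have "map_poly of_int g * (k - map_poly of_int s) = (map_poly of_int r :: 'a poly)"
    using assms(2) by (simp add: sr(1) of_int_poly.hom_add of_int_poly.hom_mult algebra_simps)
  moreover have "map_poly of_int r = (0 :: 'a poly) \<longleftrightarrow> r = 0"
    by (rule map_poly_eq_0_iff) auto
  moreover have "map_poly of_int g = (0 :: 'a poly) \<longleftrightarrow> g = 0"
    by (rule map_poly_eq_0_iff) auto
  moreover have "g \<noteq> 0"
    using assms(1) by auto
  ultimately have "k - map_poly of_int s = 0"
    using sr(2) by (metis degree_map_poly_of_int degree_mult_right_le linorder_not_le mult_eq_0_iff)
  then show thesis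
    using that[of s] by simp
qed

section \<open>Cyclotomic polynomials\<close>

lemma proper_divisors_insert:
  fixes n :: nat
  assumes "n > 0"
  shows "{d. d dvd n} = insert n {d. d dvd n \<and> d < n}"
  using assms by (auto dest: dvd_imp_le)

text \<open>Multiplicative form of Moebius uniqueness: by induction the factors at proper divisors
  agree, and their product is nonzero, so it cancels. The divisor-closed set \<open>S\<close> allows
  restricting to indices coprime to \<open>p\<close>.\<close>

lemma eq_of_prod_divisors_eq:
  fixes f g :: "nat \<Rightarrow> 'a :: idom"
  assumes "n \<in> S"
    and pos: "\<And>m. m \<in> S \<Longrightarrow> m > 0"
    and closed: "\<And>m d. m \<in> S \<Longrightarrow> d dvd m \<Longrightarrow> d \<in> S"
    and nz: "\<And>m. m \<in> S \<Longrightarrow> f m \<noteq> 0"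
    and eq: "\<And>m. m \<in> S \<Longrightarrow> (\<Prod>d | d dvd m. f d) = (\<Prod>d | d dvd m. g d)"
  shows "f n = g n"
  using assms(1)
proof (induction n rule: less_induct)
  case (less n)
  let ?D = "{d. d dvd n \<and> d < n}"
  have split: "(\<Prod>d | d dvd n. u d) = u n * (\<Prod>d\<in>?D. u d)" for u :: "nat \<Rightarrow> 'a"
    by (subst proper_divisors_insert[OF pos[OF less.prems]]) simp
  have "(\<Prod>d\<in>?D. g d) = (\<Prod>d\<in>?D. f d)"
    using less closed by (intro prod.cong) auto
  then have "f n * (\<Prod>d\<in>?D. f d) = g n * (\<Prod>d\<in>?D. f d)"
    using eq[OF less.prems] by (simp add: split)
  moreover have "(\<Prod>d\<in>?D. f d) \<noteq> 0"
    using nz closed less.prems by (subst prod_zero_iff) auto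
  ultimately show ?case
    by simp
qed

section \<open>Complex cyclotomic polynomials and their integrality\<close>

definition complex_cyclotomic :: "nat \<Rightarrow> complex poly" where
  "complex_cyclotomic n = (\<Prod>k\<in>totatives n. [:- cis (2 * pi * real k / real n), 1:])"

lemma degree_complex_cyclotomic: "Polynomial.degree (complex_cyclotomic n) = totient n"
  unfolding complex_cyclotomic_def totient_def
  by (subst degree_prod_eq_sum_degree) auto

lemma lead_coeff_complex_cyclotomic: "lead_coeff (complex_cyclotomic n) = 1"
  unfolding complex_cyclotomic_def by (subst lead_coeff_prod) simp

lemma degree_unity_poly:
  assumes "n > 0"
  shows "Polynomial.degree (Polynomial.monom 1 n - 1 :: 'a :: field poly) = n"
  using assms by (subst diff_conv_add_uminus, subst degree_add_eq_left) (auto simp: degree_monom_eq)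

lemma unity_poly_factorization:
  assumes "n > 0"
  shows "(\<Prod>k\<in>{0<..n}. [:- cis (2 * pi * real k / real n), 1:]) = Polynomial.monom 1 n - 1"
proof -
  let ?f = "\<lambda>k::nat. cis (2 * pi * real k / real n)"
  let ?p = "Polynomial.monom 1 n - 1 :: complex poly"
  have lc: "lead_coeff ?p = 1"
    using assms by (subst degree_unity_poly) simp_all
  \<comment> \<open>The derivative \<open>n X^(n-1)\<close> vanishes only at 0, which is not a root
    of \<open>X^n - 1\<close>.\<close>
  have "rsquarefree ?p"
    using assms by (auto simp: rsquarefree_roots pderiv_diff pderiv_monom poly_monom power_0_left)
  from complex_poly_decompose_rsquarefree[OF this]
  have "?p = (\<Prod>z | z ^ n = 1. [:- z, 1:])"
    by (simp only: lc smult_1_left) (simp add: poly_monom)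
  also have "\<dots> = (\<Prod>k<n. [:- ?f k, 1:])"
    by (rule prod.reindex_bij_betw[OF bij_betw_roots_unity[OF assms], symmetric])
  \<comment> \<open>Index 0 is exchanged for \<open>n\<close>, which gives the same root 1; the
    range \<open>{0<..n}\<close> is the one that \<open>totatives\<close> uses.\<close>
  also have "{..<n} = insert 0 {0<..<n}"
    using assms by auto
  also have "(\<Prod>k\<in>insert 0 {0<..<n}. [:- ?f k, 1:]) = (\<Prod>k\<in>insert n {0<..<n}. [:- ?f k, 1:])"
    using assms by (simp add: cis_2pi)
  also have "insert n {0<..<n} = {0<..n}"
    using assms by auto
  finally show ?thesis ..
qed

text \<open>The roots of unity are sorted by \<open>gcd k n\<close>: dividing by \<open>d\<close>
  turns the class with gcd \<open>d\<close> into the totatives of \<open>n div d\<close>, that is,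
  into the primitive roots of that order.\<close>

lemma prod_complex_cyclotomic:
  assumes "n > 0"
  shows "(\<Prod>d | d dvd n. complex_cyclotomic d) = Polynomial.monom 1 n - 1"
proof -
  let ?f = "\<lambda>k. [:- cis (2 * pi * real k / real n), 1:]"
  let ?A = "\<lambda>d. {k \<in> {0<..n}. gcd k n = d}"
  have cyc: "complex_cyclotomic (n div d) = (\<Prod>k\<in>?A d. ?f k)" if "d dvd n" for d
  proof -
    have "d > 0"
      using that assms by (auto intro: Nat.gr0I)
    have "(\<Prod>k\<in>?A d. ?f k) = (\<Prod>k\<in>totatives (n div d). ?f (k * d))"
      by (rule prod.reindex_bij_betw[OF bij_betw_totatives_gcd_eq[OF that assms], symmetric])
    also have "\<dots> = complex_cyclotomic (n div d)"
      unfolding complex_cyclotomic_def using that assms \<open>d > 0\<close>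
      by (intro prod.cong refl) (auto simp: real_of_nat_div mult.assoc)
    finally show ?thesis ..
  qed
  have "(\<Prod>d | d dvd n. complex_cyclotomic d) = (\<Prod>d | d dvd n. complex_cyclotomic (n div d))"
    using assms by (intro prod.reindex_bij_witness[of _ "(div) n" "(div) n"]) (auto elim: dvdE)
  also have "\<dots> = (\<Prod>d | d dvd n. \<Prod>k\<in>?A d. ?f k)"
    by (intro prod.cong refl cyc) auto
  also have "\<dots> = (\<Prod>k\<in>(\<Union>d\<in>{d. d dvd n}. ?A d). ?f k)"
    using assms by (intro prod.UNION_disjoint[symmetric]) auto
  also have "(\<Union>d\<in>{d. d dvd n}. ?A d) = {0<..n}"
    by auto
  finally show ?thesis
    by (simp add: unity_poly_factorization assms)
qed

text \<open>By induction the factors of \<open>X^n - 1\<close> at proper divisors have a monic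
  integral product, and the remaining factor is its cofactor.\<close>

lemma complex_cyclotomic_integral:
  "\<exists>P. map_poly complex_of_int P = complex_cyclotomic n"
proof (induction n rule: less_induct)
  case (less n)
  show ?case
  proof (cases "n = 0")
    case True
    have "map_poly complex_of_int 1 = complex_cyclotomic n"
      by (simp add: True complex_cyclotomic_def)
    then show ?thesis ..
  next
    case False
    let ?D = "{d. d dvd n \<and> d < n}"
    from less obtain P where P: "map_poly complex_of_int (P d) = complex_cyclotomic d" if "d < n" for d
      by metis
    let ?g = "\<Prod>d\<in>?D. P d"
    have g: "map_poly complex_of_int ?g = (\<Prod>d\<in>?D. complex_cyclotomic d)"
      unfolding of_int_poly.hom_prod by (intro prod.cong) (auto simp: P)
    have "complex_of_int (lead_coeff ?g) = lead_coeff (map_poly complex_of_int ?g)"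
      by (simp only: lead_coeff_map_poly_of_int)
    also have "\<dots> = 1"
      unfolding g by (simp add: lead_coeff_prod lead_coeff_complex_cyclotomic)
    finally have "lead_coeff ?g = 1"
      by simp
    moreover have "map_poly complex_of_int (Polynomial.monom 1 n - 1) =
        map_poly complex_of_int ?g * complex_cyclotomic n"
      using prod_complex_cyclotomic[of n] False
      by (simp add: g proper_divisors_insert of_int_poly.hom_diff map_poly_monom mult.commute)
    ultimately show ?thesis
      by (rule integral_cofactor) auto
  qed
qed

text \<open>Justifies the definite description: integrality gives existence, injectivity of the
  coefficient embedding gives uniqueness.\<close>

lemma map_poly_cyclotomic_int: "map_poly complex_of_int (cyclotomic_int n) = complex_cyclotomic n"
proof -
  have "\<exists>!P. map_poly complex_of_int P = complex_cyclotomic n"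
    using complex_cyclotomic_integral[of n]
    by (metis map_poly_of_int_eq_iff)
  then have "map_poly complex_of_int (THE P. map_poly complex_of_int P = complex_cyclotomic n)
      = complex_cyclotomic n"
    by (rule theI')
  then show ?thesis
    by (simp add: cyclotomic_int_def complex_cyclotomic_def)
qed

lemma degree_cyclotomic_int: "Polynomial.degree (cyclotomic_int n) = totient n"
  by (metis degree_complex_cyclotomic degree_map_poly_of_int map_poly_cyclotomic_int)

lemma lead_coeff_cyclotomic_int: "lead_coeff (cyclotomic_int n) = 1"
proof -
  have "complex_of_int (lead_coeff (cyclotomic_int n)) = lead_coeff (complex_cyclotomic n)"
    by (simp only: lead_coeff_map_poly_of_int flip: map_poly_cyclotomic_int)
  then show ?thesis
    by (simp add: lead_coeff_complex_cyclotomic)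
qed

lemma prod_cyclotomic_int:
  assumes "n > 0"
  shows "(\<Prod>d | d dvd n. cyclotomic_int d) = Polynomial.monom 1 n - 1"
proof -
  have "map_poly complex_of_int (\<Prod>d | d dvd n. cyclotomic_int d)
      = map_poly complex_of_int (Polynomial.monom 1 n - 1)"
    using prod_complex_cyclotomic[OF assms]
    by (simp add: of_int_poly.hom_prod map_poly_cyclotomic_int of_int_poly.hom_diff map_poly_monom)
  then show ?thesis
    by (simp only: map_poly_of_int_eq_iff)
qed

section \<open>Cyclotomic polynomials over an arbitrary field\<close>

lemma degree_cyclotomic: "Polynomial.degree (cyclotomic n :: 'a :: field poly) = totient n"
  unfolding cyclotomic_def degree_cyclotomic_int[symmetric]
  \<comment> \<open>The leading coefficient 1 survives reduction in every characteristic.\<close>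
  by (rule map_poly_degree_eq) (simp add: lead_coeff_cyclotomic_int)

lemma cyclotomic_nonzero: "cyclotomic n \<noteq> (0 :: 'a :: field poly)"
proof
  assume "cyclotomic n = (0 :: 'a poly)"
  then have "Polynomial.coeff (map_poly of_int (cyclotomic_int n) :: 'a poly) (totient n) = 0"
    by (simp add: cyclotomic_def)
  then show False
    using lead_coeff_cyclotomic_int[of n] by (simp add: coeff_map_poly degree_cyclotomic_int)
qed

lemma prod_cyclotomic:
  assumes "n > 0"
  shows "(\<Prod>d | d dvd n. cyclotomic d) = (Polynomial.monom 1 n - 1 :: 'a :: field poly)"
  using arg_cong[OF prod_cyclotomic_int[OF assms], of "map_poly of_int :: _ \<Rightarrow> 'a poly"]
  by (simp add: cyclotomic_def of_int_poly.hom_prod of_int_poly.hom_diff map_poly_monom)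

lemma reflect_unity_poly:
  assumes "n > 0"
  shows "reflect_poly (Polynomial.monom 1 n - 1 :: 'a :: field poly) = - (Polynomial.monom 1 n - 1)"
proof (rule poly_eqI)
  fix i
  show "Polynomial.coeff (reflect_poly (Polynomial.monom 1 n - 1 :: 'a poly)) i
      = Polynomial.coeff (- (Polynomial.monom 1 n - 1)) i"
    using assms by (auto simp: coeff_reflect_poly degree_unity_poly)
qed

text \<open>
  Reflection is multiplicative and changes the sign of every \<open>X^n - 1\<close>, so the reflected
  cyclotomic polynomials, corrected by the sign at \<open>n = 1\<close>, have the same divisor products.
\<close>
lemma reflect_cyclotomic:
  assumes "n > 1"
  shows "reflect_poly (cyclotomic n) = (cyclotomic n :: 'a :: field poly)"
proof -
  let ?s = "\<lambda>d::nat. if d = 1 then -1 else 1 :: 'a poly"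
  have "cyclotomic n = ?s n * (reflect_poly (cyclotomic n) :: 'a poly)"
  proof (rule eq_of_prod_divisors_eq[where n = n and S = "{m. m > 0}" and f = cyclotomic
        and g = "\<lambda>d. ?s d * reflect_poly (cyclotomic d)"])
    fix m :: nat assume "m \<in> {m. m > 0}"
    then have m: "m > 0" by simp
    have "(\<Prod>d | d dvd m. ?s d) = (\<Prod>d\<in>{1}. ?s d)"
      using m by (intro prod.mono_neutral_right) auto
    then show "(\<Prod>d | d dvd m. cyclotomic d) = (\<Prod>d | d dvd m. ?s d * (reflect_poly (cyclotomic d) :: 'a poly))"
      using m by (simp add: prod.distrib prod_cyclotomic reflect_unity_poly flip: reflect_poly_prod)
  qed (use assms in \<open>auto simp: cyclotomic_nonzero intro: Nat.gr0I\<close>)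
  then show ?thesis
    using assms by simp
qed

lemma cyclotomic_palindromic:
  assumes "n > 1" and "i \<le> totient n"
  shows "Polynomial.coeff (cyclotomic n :: 'a :: field poly) (totient n - i) = Polynomial.coeff (cyclotomic n) i"
proof -
  have "Polynomial.coeff (reflect_poly (cyclotomic n :: 'a poly)) i
      = Polynomial.coeff (cyclotomic n) (totient n - i)"
    using assms by (simp add: coeff_reflect_poly degree_cyclotomic)
  then show ?thesis
    unfolding reflect_cyclotomic[OF assms(1)] ..
qed

section \<open>Cyclotomic polynomials and Frobenius\<close>

lemma freshmans_dream_diff:
  fixes x y :: "'a :: comm_ring_1"
  assumes "Factorial_Ring.prime CHAR('a)" and "m = CHAR('a) ^ k"
  shows "(x - y) ^ m = x ^ m - y ^ m"
  \<comment> \<open>Adding \<open>y\<close> back to \<open>x - y\<close> avoids evaluating the sign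
    \<open>(-1) ^ m\<close>.\<close>
  using freshmans_dream'[OF assms, of "x - y" y] by simp

text \<open>The exponent \<open>i\<close> is recovered as the multiplicity of \<open>p\<close>,
  since no divisor of \<open>m\<close> contains \<open>p\<close>; then \<open>d\<close> follows by
  cancellation.\<close>

lemma bij_betw_divisors_prime_power_mult:
  fixes p m :: nat
  assumes p: "Factorial_Ring.prime p" and "coprime p m" and "m > 0"
  shows "bij_betw (\<lambda>(d, i). p ^ i * d) ({d. d dvd m} \<times> {..a}) {d. d dvd p ^ a * m}"
  unfolding bij_betw_def
proof
  have mult: "multiplicity p (p ^ i * d) = i" if "d dvd m" for i d
  proof -
    have "\<not> p dvd d"
      using that assms by (meson coprime_common_divisor dvd_trans dvd_refl not_prime_unit)
    moreover have "d \<noteq> 0"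
      using that assms by auto
    ultimately show ?thesis
      using p by (simp add: prime_elem_multiplicity_mult_distrib not_dvd_imp_multiplicity_0)
  qed
  show "inj_on (\<lambda>(d, i). p ^ i * d) ({d. d dvd m} \<times> {..a})"
  proof (rule inj_onI, clarify)
    fix d i d' i' assume *: "d dvd m" "d' dvd m" "p ^ i * d = p ^ i' * d'"
    then have "i = i'"
      by (metis mult)
    with * p show "d = d' \<and> i = i'"
      by auto
  qed
  show "(\<lambda>(d, i). p ^ i * d) ` ({d. d dvd m} \<times> {..a}) = {d. d dvd p ^ a * m}"
  proof (intro equalityI subsetI)
    fix x assume "x \<in> {d. d dvd p ^ a * m}"
    then obtain b c where "x = b * c" "b dvd p ^ a" "c dvd m"
      using division_decomp[of x "p ^ a" m] by auto
    moreover from this obtain i where "i \<le> a" "b = p ^ i"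
      using divides_primepow_nat[OF p] by auto
    ultimately show "x \<in> (\<lambda>(d, i). p ^ i * d) ` ({d. d dvd m} \<times> {..a})"
      by (intro image_eqI[of _ _ "(c, i)"]) auto
  qed (auto intro: mult_dvd_mono le_imp_power_dvd)
qed

text \<open>As functions of \<open>m\<close> coprime to \<open>p\<close>, both sides have divisor
  product \<open>X^(p^a m) - 1 = (X^m - 1)^(p^a)\<close>.\<close>

lemma prod_cyclotomic_prime_powers:
  fixes m :: nat
  assumes p: "Factorial_Ring.prime p" "CHAR('a :: field) = p" and "coprime p m" and "m > 0"
  shows "(\<Prod>i\<le>a. cyclotomic (p ^ i * m)) = (cyclotomic m :: 'a poly) ^ (p ^ a)"
proof (rule eq_of_prod_divisors_eq[where n = m and S = "{m. m > 0 \<and> coprime p m}"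
      and f = "\<lambda>m. \<Prod>i\<le>a. cyclotomic (p ^ i * m)" and g = "\<lambda>m. cyclotomic m ^ (p ^ a)"])
  fix m assume "m \<in> {m. m > 0 \<and> coprime p m}"
  then have m: "m > 0" "coprime p m" by auto
  have "p > 0"
    using p by (simp add: prime_gt_0_nat)
  have "(\<Prod>d | d dvd m. \<Prod>i\<le>a. cyclotomic (p ^ i * d)) =
      (\<Prod>(d, i)\<in>{d. d dvd m} \<times> {..a}. cyclotomic (p ^ i * d) :: 'a poly)"
    by (rule prod.cartesian_product)
  also have "\<dots> = (\<Prod>d | d dvd p ^ a * m. cyclotomic d)"
    using prod.reindex_bij_betw[OF bij_betw_divisors_prime_power_mult[OF p(1) m(2,1)],
        of "cyclotomic :: _ \<Rightarrow> 'a poly"]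
    by (simp add: case_prod_unfold)
  also have "\<dots> = Polynomial.monom 1 m ^ (p ^ a) - 1 ^ (p ^ a)"
    using m \<open>p > 0\<close> by (simp add: prod_cyclotomic monom_power mult.commute)
  also have "\<dots> = (Polynomial.monom 1 m - 1) ^ (p ^ a)"
    using p by (intro freshmans_dream_diff[symmetric]) auto
  also have "\<dots> = (\<Prod>d | d dvd m. cyclotomic d ^ (p ^ a))"
    using m by (simp add: prod_power_distrib[symmetric] prod_cyclotomic)
  finally show "(\<Prod>d | d dvd m. \<Prod>i\<le>a. cyclotomic (p ^ i * d)) =
      (\<Prod>d | d dvd m. (cyclotomic d :: 'a poly) ^ (p ^ a))" .
qed (use assms in \<open>auto simp: cyclotomic_nonzero intro: Nat.gr0I dest: coprime_divisors[OF dvd_refl]\<close>)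

text \<open>Compare the preceding product for \<open>a\<close> and \<open>a - 1\<close>: the extra
  factor is the one at \<open>p^a m\<close>, and the exponents differ by
  \<open>p^a - p^(a-1) = totient (p^a)\<close>.\<close>

lemma cyclotomic_prime_power_mult:
  fixes m :: nat
  assumes p: "Factorial_Ring.prime p" "CHAR('a :: field) = p" and m: "coprime p m" "m > 0"
  shows "cyclotomic (p ^ a * m) = (cyclotomic m :: 'a poly) ^ totient (p ^ a)"
proof (cases a)
  case (Suc b)
  note prod = prod_cyclotomic_prime_powers[OF p m]
  have "totient (p ^ a) + p ^ b = p ^ a"
    unfolding Suc totient_prime_power_Suc[OF p(1)] using prime_gt_0_nat[OF p(1)] by (cases p) simp_all
  then have "cyclotomic m ^ p ^ b * cyclotomic (p ^ a * m) =
      cyclotomic m ^ p ^ b * (cyclotomic m :: 'a poly) ^ totient (p ^ a)"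
    using prod[of b] prod[of a] by (simp add: Suc add.commute flip: power_add)
  then show ?thesis
    by (simp add: cyclotomic_nonzero)
qed simp

section \<open>Lucas polynomials and Lucas atoms in the algebraic closure\<close>

interpretation to_closure: comm_ring_morphism "to_closure :: 'a :: field poly poly \<Rightarrow> _"
  by standard (simp_all add: to_closure_def)

text \<open>Identities in \<open>F[B,C]\<close> may therefore be checked on the roots in the
  closure.\<close>

lemma to_closure_eq_iff: "to_closure P = to_closure Q \<longleftrightarrow> P = Q"
  by (simp add: to_closure_def)

interpretation closure_const: comm_ring_morphism "\<lambda>c :: 'a :: field. to_closure [:[:c:]:]"
  by standard (simp_all add: to_closure.hom_one flip: to_closure.hom_add to_closure.hom_mult one_pCons)

interpretation closure_const_poly: comm_ring_morphism "map_poly (\<lambda>c :: 'a :: field. to_closure [:[:c:]:])"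
  by (rule closure_const.map_poly_morphism)

definition lucas_roots :: "'a :: field poly poly fract alg_closure \<Rightarrow> 'a poly poly fract alg_closure \<Rightarrow> bool" where
  "lucas_roots \<alpha> \<beta> \<longleftrightarrow> [:- \<alpha>, 1:] * [:- \<beta>, 1:] = [:to_closure var_C, to_closure var_B, 1:]"

text \<open>Vieta's formulas.\<close>

lemma lucas_roots_iff:
  "lucas_roots \<alpha> \<beta> \<longleftrightarrow> to_closure var_B = - (\<alpha> + \<beta>) \<and> to_closure var_C = \<alpha> * \<beta>"
  by (auto simp: lucas_roots_def algebra_simps)

lemma lucas_roots_var:
  assumes "lucas_roots \<alpha> \<beta>"
  shows "to_closure var_B = - (\<alpha> + \<beta>)" and "to_closure var_C = \<alpha> * \<beta>"
  using assms by (simp_all add: lucas_roots_iff)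

lemma lucas_roots_exist: "\<exists>\<alpha> \<beta>. lucas_roots \<alpha> (\<beta> :: 'a :: field poly poly fract alg_closure)"
proof -
  let ?p = "[:to_closure var_C, to_closure var_B, 1:] :: 'a poly poly fract alg_closure poly"
  obtain A where A: "size A = Polynomial.degree ?p" "?p = smult (lead_coeff ?p) (\<Prod>x\<in>#A. [:- x, 1:])"
    using alg_closed_imp_factorization[of ?p] by auto
  from A(1) have "size A = Suc 1"
    by simp
  then obtain \<alpha> A' where "A = add_mset \<alpha> A'" "size A' = 1"
    by (metis add_diff_cancel_left' plus_1_eq_Suc size_add_mset size_eq_Suc_imp_eq_union)
  moreover from this obtain \<beta> where "A' = {#\<beta>#}"
    using size_1_singleton_mset by blast
  ultimately have "A = {#\<alpha>, \<beta>#}"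
    by simp
  with A(2) have "lucas_roots \<alpha> \<beta>"
    unfolding lucas_roots_def by simp
  then show ?thesis
    by blast
qed

section \<open>Binet formulas and the discriminant\<close>

lemma to_closure_lucas_V:
  assumes "lucas_roots \<alpha> \<beta>"
  shows "to_closure (lucas_V n) = \<alpha> ^ n + \<beta> ^ n"
proof (induction n rule: lucas_V.induct)
  case (3 n)
  then show ?case
    by (simp add: lucas_roots_var[OF assms] to_closure.hom_diff to_closure.hom_mult to_closure.hom_uminus algebra_simps)
qed (simp_all add: lucas_roots_var[OF assms] to_closure.hom_numeral to_closure.hom_uminus)

text \<open>Powers of either root satisfy the recurrence. The factor
  \<open>\<alpha> - \<beta>\<close> stays on the left to avoid a division;
  \<open>lucas_roots_neq\<close> later cancels it.\<close>

lemma to_closure_lucas_U: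
  assumes "lucas_roots \<alpha> \<beta>"
  shows "(\<alpha> - \<beta>) * to_closure (lucas_U n) = \<alpha> ^ n - \<beta> ^ n"
proof (induction n rule: lucas_U.induct)
  case (3 n)
  have "(\<alpha> - \<beta>) * to_closure (lucas_U (Suc (Suc n))) =
      (\<alpha> + \<beta>) * ((\<alpha> - \<beta>) * to_closure (lucas_U (Suc n))) - \<alpha> * \<beta> * ((\<alpha> - \<beta>) * to_closure (lucas_U n))"
    by (simp add: lucas_roots_var[OF assms] to_closure.hom_diff to_closure.hom_mult to_closure.hom_uminus algebra_simps)
  then show ?case
    unfolding 3 by (simp add: algebra_simps)
qed (simp_all add: to_closure.hom_zero to_closure.hom_one)

lemma to_closure_discriminant:
  assumes "lucas_roots \<alpha> \<beta>"
  shows "to_closure (var_B ^ 2 - 4 * var_C) = (\<alpha> - \<beta>) ^ 2"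
  by (simp add: lucas_roots_var[OF assms] to_closure.hom_diff to_closure.hom_mult to_closure.hom_power
      to_closure.hom_numeral power2_eq_square algebra_simps)

lemma discriminant_nonzero: "var_B ^ 2 - 4 * var_C \<noteq> (0 :: 'a :: field poly poly)"
proof
  assume "var_B ^ 2 - 4 * var_C = (0 :: 'a poly poly)"
  \<comment> \<open>The part free of \<open>C\<close> is \<open>B^2\<close>, which is nonzero in
    every characteristic, including 2.\<close>
  then have "Polynomial.coeff (var_B ^ 2 - 4 * var_C :: 'a poly poly) 0 = 0"
    by simp
  then show False
    by (simp add: var_B_def var_C_def power2_eq_square coeff_mult_0)
qed

lemma lucas_roots_neq:
  assumes "lucas_roots \<alpha> (\<beta> :: 'a :: field poly poly fract alg_closure)"
  shows "\<alpha> \<noteq> \<beta>"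
proof
  assume "\<alpha> = \<beta>"
  then have "to_closure (var_B ^ 2 - 4 * var_C) = to_closure (0 :: 'a poly poly)"
    using to_closure_discriminant[OF assms] by (simp add: to_closure.hom_zero)
  then show False
    unfolding to_closure_eq_iff using discriminant_nonzero by blast
qed

lemma lucas_roots_nonzero:
  assumes "lucas_roots \<alpha> (\<beta> :: 'a :: field poly poly fract alg_closure)"
  shows "\<beta> \<noteq> 0"
proof
  assume "\<beta> = 0"
  then have "to_closure var_C = to_closure (0 :: 'a poly poly)"
    using assms by (simp add: lucas_roots_iff to_closure.hom_zero)
  then show False
    unfolding to_closure_eq_iff by (simp add: var_C_def)
qed

text \<open>
  Splitting off the two outer terms leaves \<open>\<alpha> \<beta>\<close> times a shorter palindromic form, and
  the outer terms combine to a multiple of \<open>lucas_V\<close>.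
\<close>
lemma palindromic_form_polynomial:
  fixes c :: "nat \<Rightarrow> 'a :: field"
  assumes "\<And>i. i \<le> m \<Longrightarrow> c (m - i) = c i"
  shows "\<exists>L. \<forall>\<alpha> \<beta>. lucas_roots \<alpha> \<beta> \<longrightarrow>
    to_closure L = (\<Sum>i\<le>m. to_closure [:[:c i:]:] * \<alpha> ^ i * \<beta> ^ (m - i))"
  using assms
proof (induction m arbitrary: c rule: induct_nat_012)
  case 0
  show ?case
    by (rule exI[of _ "[:[:c 0:]:]"]) simp
next
  case 1
  have "c 1 = c 0"
    using "1"[of 0] by simp
  show ?case
  proof (intro exI allI impI)
    fix \<alpha> \<beta> :: "'a poly poly fract alg_closure" assume "lucas_roots \<alpha> \<beta>"
    \<comment> \<open>In degree 1 the form is a multiple of the sum of the roots, which is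
      \<open>- B\<close>.\<close>
    then have "to_closure ([:[:c 0:]:] * - var_B) = to_closure [:[:c 0:]:] * (\<alpha> + \<beta>)"
      by (simp only: to_closure.hom_mult to_closure.hom_uminus lucas_roots_iff minus_minus)
    then show "to_closure ([:[:c 0:]:] * - var_B) =
        (\<Sum>i\<le>Suc 0. to_closure [:[:c i:]:] * \<alpha> ^ i * \<beta> ^ (Suc 0 - i))"
      using \<open>c 1 = c 0\<close> by (simp add: algebra_simps del: mult_pCons_left)
  qed
next
  case (ge2 m)
  \<comment> \<open>The inner coefficients, shifted by one, are again palindromic, now of length
    \<open>m\<close>.\<close>
  have "c (Suc (m - i)) = c (Suc i)" if "i \<le> m" for i
    using ge2(3)[of "Suc i"] that by (simp add: Suc_diff_le)
  then obtain L where L: "to_closure L = (\<Sum>i\<le>m. to_closure [:[:c (Suc i):]:] * \<alpha> ^ i * \<beta> ^ (m - i))"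
    if "lucas_roots \<alpha> \<beta>" for \<alpha> \<beta>
    using ge2(1)[of "\<lambda>i. c (Suc i)"] by blast
  have outer: "c (Suc (Suc m)) = c 0"
    using ge2(3)[of 0] by simp
  show ?case
  proof (intro exI allI impI)
    fix \<alpha> \<beta> :: "'a poly poly fract alg_closure" assume roots: "lucas_roots \<alpha> \<beta>"
    let ?t = "\<lambda>i. to_closure [:[:c i:]:] * \<alpha> ^ i * \<beta> ^ (Suc (Suc m) - i)"
    have "(\<Sum>i\<le>Suc (Suc m). ?t i) = ?t 0 + (\<Sum>i\<le>m. ?t (Suc i)) + ?t (Suc (Suc m))"
      by (subst sum.atMost_Suc, subst sum.atMost_Suc_shift) simp
    also have "(\<Sum>i\<le>m. ?t (Suc i)) = \<alpha> * \<beta> * to_closure L"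
      unfolding L[OF roots] sum_distrib_left
      by (intro sum.cong refl) (simp add: Suc_diff_le algebra_simps)
    also have "?t 0 + \<alpha> * \<beta> * to_closure L + ?t (Suc (Suc m)) =
        to_closure ([:[:c 0:]:] * lucas_V (Suc (Suc m)) + var_C * L)"
      unfolding to_closure.hom_add to_closure.hom_mult to_closure_lucas_V[OF roots] lucas_roots_var[OF roots]
      by (simp add: outer algebra_simps)
    finally show "to_closure ([:[:c 0:]:] * lucas_V (Suc (Suc m)) + var_C * L) = (\<Sum>i\<le>Suc (Suc m). ?t i)" ..
  qed
qed

section \<open>Lucas atoms as homogenised cyclotomic polynomials\<close>

lemma cyclotomic_hom_eq_sum:
  assumes "\<beta> \<noteq> 0"
  shows "cyclotomic_hom n \<alpha> \<beta> = (\<Sum>i\<le>totient n.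
    to_closure [:[:Polynomial.coeff (cyclotomic n) i:]:] * \<alpha> ^ i * \<beta> ^ (totient n - i))"
proof -
  let ?q = "map_poly (\<lambda>c. to_closure [:[:c:]:]) (cyclotomic n)"
  \<comment> \<open>With this bound \<open>\<beta> ^ totient n\<close> clears all denominators of
    \<open>\<alpha> / \<beta>\<close>.\<close>
  have "Polynomial.degree ?q \<le> totient n"
    using map_poly_degree_leq[of _ "cyclotomic n"] by (simp add: degree_cyclotomic)
  then have "poly ?q (\<alpha> / \<beta>) = (\<Sum>i\<le>totient n. Polynomial.coeff ?q i * (\<alpha> / \<beta>) ^ i)"
    by (subst poly_altdef, intro sum.mono_neutral_left) (auto simp: coeff_eq_0)
  then show ?thesis
    unfolding cyclotomic_hom_def sum_distrib_left using assms
    by (auto simp: sum_distrib_left coeff_map_poly to_closure.hom_zero power_divide power_diff intro!: sum.cong)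
qed

text \<open>Uniqueness in the definite description needs an actual pair of roots, since otherwise
  its condition would be vacuous; injectivity of \<open>to_closure\<close> then decides.\<close>

lemma lucas_atom_eqI:
  fixes L :: "'a :: field poly poly"
  assumes "n \<noteq> 1" and "\<And>\<alpha> \<beta>. lucas_roots \<alpha> \<beta> \<Longrightarrow> to_closure L = cyclotomic_hom n \<alpha> \<beta>"
  shows "lucas_atom n = L"
proof -
  obtain \<alpha> \<beta> :: "'a poly poly fract alg_closure" where roots: "lucas_roots \<alpha> \<beta>"
    using lucas_roots_exist by blast
  have "(THE L. \<forall>\<alpha> \<beta>. lucas_roots \<alpha> \<beta> \<longrightarrow> to_closure L = cyclotomic_hom n \<alpha> \<beta>) = L"
  proof (rule the_equality)
    fix L' :: "'a poly poly" assume "\<forall>\<alpha> \<beta>. lucas_roots \<alpha> \<beta> \<longrightarrow> to_closure L' = cyclotomic_hom n \<alpha> \<beta>"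
    then have "to_closure L' = to_closure L"
      using roots assms(2) by simp
    then show "L' = L"
      by (simp add: to_closure_eq_iff)
  qed (use assms(2) in blast)
  then show ?thesis
    using assms(1) by (simp add: lucas_atom_def lucas_roots_def)
qed

lemma to_closure_lucas_atom:
  assumes "n > 1" and "lucas_roots \<alpha> \<beta>"
  shows "to_closure (lucas_atom n) = cyclotomic_hom n \<alpha> (\<beta> :: 'a :: field poly poly fract alg_closure)"
proof -
  obtain L :: "'a poly poly" where L: "to_closure L = cyclotomic_hom n \<alpha> \<beta>"
    if "lucas_roots \<alpha> \<beta>" for \<alpha> \<beta> :: "'a poly poly fract alg_closure"
    using palindromic_form_polynomial[of "totient n" "Polynomial.coeff (cyclotomic n :: 'a poly)",
        OF cyclotomic_palindromic[OF assms(1)]]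
    by (auto simp: cyclotomic_hom_eq_sum lucas_roots_nonzero)
  then have "lucas_atom n = L"
    using assms(1) by (intro lucas_atom_eqI) auto
  then show ?thesis
    using L assms(2) by simp
qed

section \<open>Characteristic \<open>p\<close>\<close>

text \<open>Homogenisation respects the cyclotomic power identity because \<open>totient\<close> is
  multiplicative on coprime arguments. The case \<open>m = 1\<close> is excluded, where the atom is
  set by convention.\<close>

lemma lucas_atom_prime_power_mult:
  assumes p: "Factorial_Ring.prime p" "CHAR('a :: field) = p" and "coprime p m" and "m > 1"
  shows "lucas_atom (p ^ a * m) = (lucas_atom m :: 'a poly poly) ^ totient (p ^ a)"
proof (rule lucas_atom_eqI)
  show "p ^ a * m \<noteq> 1"
    using \<open>m > 1\<close> by auto
  fix \<alpha> \<beta> :: "'a poly poly fract alg_closure" assume roots: "lucas_roots \<alpha> \<beta>"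
  have "totient (p ^ a * m) = totient m * totient (p ^ a)"
    using assms by (simp add: totient_mult_coprime)
  then show "to_closure (lucas_atom m ^ totient (p ^ a)) = cyclotomic_hom (p ^ a * m) \<alpha> \<beta>"
    using assms roots
    by (simp add: to_closure.hom_power to_closure_lucas_atom cyclotomic_hom_def cyclotomic_prime_power_mult
        closure_const_poly.hom_power power_mult_distrib poly_power power_mult)
qed

text \<open>The embedding into the fraction field is injective, so the same natural numbers vanish
  there.\<close>

lemma CHAR_lucas_closure: "CHAR('a :: field poly poly fract alg_closure) = CHAR('a)"
proof -
  have "of_nat n = (0 :: 'a poly poly fract) \<longleftrightarrow> of_nat n = (0 :: 'a poly poly)" for n
  proof -
    have "to_fract (of_nat n :: 'a poly poly) = of_nat n"
      by (induction n) simp_all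
    then show ?thesis
      by (metis to_fract_eq_0_iff)
  qed
  then have "CHAR('a poly poly fract) = CHAR('a poly poly)"
    by (intro CHAR_eqI) (auto simp: of_nat_eq_0_iff_char_dvd)
  then show ?thesis
    by simp
qed

lemma lucas_V_prime_power_mult:
  assumes p: "Factorial_Ring.prime p" "CHAR('a :: field) = p"
  shows "lucas_V (p ^ a * m) = (lucas_V m :: 'a poly poly) ^ (p ^ a)"
proof -
  obtain \<alpha> \<beta> :: "'a poly poly fract alg_closure" where roots: "lucas_roots \<alpha> \<beta>"
    using lucas_roots_exist by blast
  have "(\<alpha> ^ m + \<beta> ^ m) ^ (p ^ a) = (\<alpha> ^ m) ^ (p ^ a) + (\<beta> ^ m) ^ (p ^ a)"
    by (rule freshmans_dream'[where n = a]) (simp_all add: p CHAR_lucas_closure del: CHAR_alg_closure)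
  then have "to_closure (lucas_V (p ^ a * m)) = to_closure (lucas_V m ^ (p ^ a) :: 'a poly poly)"
    by (simp add: to_closure.hom_power to_closure_lucas_V[OF roots] mult.commute flip: power_mult)
  then show ?thesis
    by (simp add: to_closure_eq_iff)
qed

text \<open>Frobenius applied to the Binet formula produces
  \<open>(\<alpha> - \<beta>) ^ (p ^ a)\<close>; cancelling one factor leaves the exponent
  \<open>p ^ a - 1\<close>.\<close>

lemma to_closure_lucas_U_prime_power_mult:
  assumes p: "Factorial_Ring.prime p" "CHAR('a :: field) = p"
    and roots: "lucas_roots \<alpha> (\<beta> :: 'a poly poly fract alg_closure)"
  shows "to_closure (lucas_U (p ^ a * m)) = (\<alpha> - \<beta>) ^ (p ^ a - 1) * to_closure (lucas_U m) ^ (p ^ a)"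
proof -
  have "p ^ a > 0"
    using p(1) by (simp add: prime_gt_0_nat)
  have "(\<alpha> ^ m - \<beta> ^ m) ^ (p ^ a) = (\<alpha> ^ m) ^ (p ^ a) - (\<beta> ^ m) ^ (p ^ a)"
    by (rule freshmans_dream_diff[where k = a]) (simp_all add: p CHAR_lucas_closure del: CHAR_alg_closure)
  then have "(\<alpha> - \<beta>) * to_closure (lucas_U (p ^ a * m)) = ((\<alpha> - \<beta>) * to_closure (lucas_U m)) ^ (p ^ a)"
    by (simp add: to_closure_lucas_U[OF roots] mult.commute[of "p ^ a" m] flip: power_mult)
  also have "\<dots> = (\<alpha> - \<beta>) * ((\<alpha> - \<beta>) ^ (p ^ a - 1) * to_closure (lucas_U m) ^ (p ^ a))"
    using power_minus_mult[OF \<open>p ^ a > 0\<close>, of "\<alpha> - \<beta>"] by (simp add: power_mult_distrib mult_ac)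
  finally show ?thesis
    using lucas_roots_neq[OF roots] by simp
qed

lemma lucas_U_prime_power_mult_odd:
  assumes p: "Factorial_Ring.prime p" "CHAR('a :: field) = p" and "odd p"
  shows "lucas_U (p ^ a * m) =
    (var_B ^ 2 - 4 * var_C) ^ ((p ^ a - 1) div 2) * (lucas_U m :: 'a poly poly) ^ (p ^ a)"
proof -
  obtain \<alpha> \<beta> :: "'a poly poly fract alg_closure" where roots: "lucas_roots \<alpha> \<beta>"
    using lucas_roots_exist by blast
  \<comment> \<open>Since \<open>p ^ a\<close> is odd the halving is exact, so the power of
    \<open>\<alpha> - \<beta>\<close> is a power of its square, the discriminant.\<close>
  have "2 * ((p ^ a - 1) div 2) = p ^ a - 1"
    using \<open>odd p\<close> by simp
  then have "(\<alpha> - \<beta>) ^ (p ^ a - 1) = to_closure ((var_B ^ 2 - 4 * var_C) ^ ((p ^ a - 1) div 2))"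
    by (simp only: to_closure.hom_power to_closure_discriminant[OF roots] flip: power_mult)
  then have "to_closure (lucas_U (p ^ a * m)) =
      to_closure ((var_B ^ 2 - 4 * var_C) ^ ((p ^ a - 1) div 2) * (lucas_U m :: 'a poly poly) ^ (p ^ a))"
    by (simp only: to_closure_lucas_U_prime_power_mult[OF p roots] to_closure.hom_mult to_closure.hom_power)
  then show ?thesis
    by (simp only: to_closure_eq_iff)
qed

lemma lucas_U_power_2_mult:
  assumes p: "CHAR('a :: field) = 2"
  shows "lucas_U (2 ^ a * m) = var_B ^ (2 ^ a - 1) * (lucas_U m :: 'a poly poly) ^ (2 ^ a)"
proof -
  obtain \<alpha> \<beta> :: "'a poly poly fract alg_closure" where roots: "lucas_roots \<alpha> \<beta>"
    using lucas_roots_exist by blast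
  have "of_nat 2 = (0 :: 'a poly poly fract alg_closure)"
    by (simp only: of_nat_eq_0_iff_char_dvd CHAR_lucas_closure p dvd_refl)
  \<comment> \<open>In characteristic 2 the signs of \<open>\<alpha>\<close> and
    \<open>- \<alpha>\<close> agree, which turns the difference of the roots into minus their sum,
    that is, \<open>B\<close>.\<close>
  then have "2 * \<alpha> = 0"
    by simp
  then have "\<alpha> - \<beta> = - (\<alpha> + \<beta>)"
    by (simp add: algebra_simps mult_2 eq_neg_iff_add_eq_0)
  then have "\<alpha> - \<beta> = to_closure var_B"
    using roots by (simp add: lucas_roots_iff)
  then have "to_closure (lucas_U (2 ^ a * m)) =
      to_closure (var_B ^ (2 ^ a - 1) * (lucas_U m :: 'a poly poly) ^ (2 ^ a))"
    by (simp only: to_closure_lucas_U_prime_power_mult[OF two_is_prime_nat p roots]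
        to_closure.hom_mult to_closure.hom_power)
  then show ?thesis
    by (simp only: to_closure_eq_iff)
qed

text \<open>The condition on \<open>n'\<close> in the first part excludes \<open>n' = 1\<close> with
  \<open>a > 0\<close>: there \<open>lucas_atom n' = 1\<close> by convention, while the atom at
  \<open>p^a\<close> is a nontrivial power of \<open>\<alpha> - \<beta>\<close>.\<close>

theorem lemma3p6:
  fixes p q e n n' a :: nat
  assumes "Factorial_Ring.prime p" and "e > 0" and "q = p ^ e"
    and "card (UNIV :: 'a :: finite_field set) = q"
    and "n > 0" and "n = p ^ a * n'" and "a = multiplicity p n" and "coprime p n'"
  shows "((n' = 1 \<longrightarrow> a = 0) \<longrightarrow>
            (lucas_atom n :: 'a poly poly) = lucas_atom n' ^ totient (p ^ a))
       \<and> (lucas_V n :: 'a poly poly) = lucas_V n' ^ (p ^ a)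
       \<and> (odd p \<longrightarrow> (lucas_U n :: 'a poly poly) =
            (var_B ^ 2 - 4 * var_C) ^ ((p ^ a - 1) div 2) * lucas_U n' ^ (p ^ a))
       \<and> (p = 2 \<longrightarrow> (lucas_U n :: 'a poly poly) =
            var_B ^ (2 ^ a - 1) * lucas_U n' ^ (2 ^ a))"
proof -
  \<comment> \<open>The characteristic of a finite field is a prime dividing its cardinality
    \<open>p ^ e\<close>, hence equals \<open>p\<close>.\<close>
  have "Factorial_Ring.prime CHAR('a)"
    by simp
  moreover have "CHAR('a) dvd p ^ e"
    using CHAR_dvd_CARD[where ?'a = 'a] assms(3,4) by simp
  ultimately have char: "CHAR('a) = p"
    using assms(1) by (metis prime_dvd_power primes_dvd_imp_eq)
  have "n' > 0"
    using assms(5,6) by (auto intro: Nat.gr0I)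
  have "lucas_atom n = (lucas_atom n' :: 'a poly poly) ^ totient (p ^ a)" if "n' = 1 \<longrightarrow> a = 0"
  proof (cases "n' = 1")
    case True
    then show ?thesis
      using that assms(6) by simp
  next
    case False
    then show ?thesis
      using lucas_atom_prime_power_mult[OF assms(1) char assms(8)] \<open>n' > 0\<close> assms(6) by simp
  qed
  then show ?thesis
    using assms(1,6) char lucas_V_prime_power_mult[OF assms(1) char]
      lucas_U_prime_power_mult_odd[OF assms(1) char] lucas_U_power_2_mult[where ?'a = 'a]
    by auto
qed

end
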